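(* For any integer $k \geq 3$, there is a $(v,k)$-modular Golomb ruler for some integer $v \leq 3k^2/2$.
   Context: For an integer $k\ge 3$ and a positive integer $v$, a $(v,k)$-modular Golomb ruler ($(v,k)$-MGR) is a set of $k$ distinct integers $0 \leq x_1 < x_2 < \cdots < x_k \leq v-1$ such that all the differences $x_j - x_i \bmod v$ (over ordered pairs $(i,j)$ with $i \neq j$) are distinct elements of $\mathbb{Z}_v$. *)

theory Defs
  imports Complex_Main
begin

(* The marks x_1 < ... < x_k are represented by the set X of their values, and elements of Z_v
   by their residues in {0..<v}; the differences are indexed by ordered pairs of distinct marks. *)
definition modular_golomb_ruler :: "nat \<Rightarrow> nat \<Rightarrow> int set \<Rightarrow> bool" where
  "modular_golomb_ruler v k X \<longleftrightarrow>
     k \<ge> 3 \<and> v > 0 \<and> X \<subseteq> {0..int v - 1} \<and> card X = k \<and>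
     inj_on (\<lambda>(x, y). (y - x) mod int v) {(x, y). x \<in> X \<and> y \<in> X \<and> x \<noteq> y}"

end

theory Submission
  imports Defs "HOL-Number_Theory.Number_Theory" "HOL-Analysis.Harmonic_Numbers"
begin

text \<open>
  Deleting marks from a ruler leaves a ruler, so it suffices to find, for each \<open>k\<close>, a modulus
  \<open>v \<le> 3 k\<^sup>2 / 2\<close> carrying a ruler with at least \<open>k\<close> marks. Ruzsa's construction
  (\<open>ruzsa_ruler\<close>) gives a \<open>(p (p - 1), p - 1)\<close>-ruler for every prime \<open>p \<ge> 5\<close>: its marks are the
  solutions of \<open>x \<equiv> i\<close> modulo \<open>p - 1\<close> and \<open>x \<equiv> g ^ i\<close> modulo \<open>p\<close>, where \<open>g\<close> is a primitive root.
  Hence a prime \<open>p > k\<close> with \<open>2 p (p - 1) \<le> 3 k\<^sup>2\<close> is enough, and for this it suffices that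
  \<open>k < p \<le> 1.22 k\<close>.

  For \<open>k \<ge> 10 ^ 6\<close> such a prime exists by Chebyshev's method (\<open>prime_between\<close>). The
  expression \<open>ln n! + ln \<lfloor>n/30\<rfloor>! - ln \<lfloor>n/2\<rfloor>! - ln \<lfloor>n/3\<rfloor>! - ln \<lfloor>n/5\<rfloor>!\<close> equals
  \<open>A n + O(ln n)\<close> for an explicit constant \<open>A\<close>. It is also a sum of the von Mangoldt function
  with weights \<open>0\<close> and \<open>1\<close>, which lies between \<open>\<psi>(n) - \<psi>(n/6)\<close> and \<open>\<psi>(n)\<close>. So \<open>\<psi>(n) \<ge> A n - O(ln n)\<close>, and by iteration
  \<open>\<psi>(n) \<le> (6/5) A n + O(ln\<^sup>2 n)\<close>. As \<open>1.22 > 6/5\<close>, \<open>\<psi>(1.22 k) - \<psi>(k)\<close> grows linearly in \<open>k\<close>, while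
  proper prime powers contribute only \<open>O(\<surd>k ln k)\<close> to it (\<open>psi_diff_le_if_no_primes\<close>).

  Below \<open>10 ^ 6\<close>, explicit chains of primes cover all \<open>k\<close> except \<open>3, 5, 7, 8, 13, 23\<close>, for which
  subsets of Singer difference sets, which have \<open>q + 1\<close> marks modulo \<open>q\<^sup>2 + q + 1\<close>, are used for
  \<open>q = 2, 5, 7, 13, 23\<close>.
\<close>

section \<open>Ruzsa's construction\<close>

lemma modular_golomb_ruler_shrink:
  assumes "modular_golomb_ruler v k X" "3 \<le> m" "m \<le> k"
  shows "\<exists>Y. modular_golomb_ruler v m Y"
proof -
  from assms have "m \<le> card X" by (simp add: modular_golomb_ruler_def)
  then obtain Y where Y: "Y \<subseteq> X" "card Y = m"
    by (metis obtain_subset_with_card_n)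
  have "inj_on (\<lambda>(x, y). (y - x) mod int v) {(x, y). x \<in> Y \<and> y \<in> Y \<and> x \<noteq> y}"
    by (rule inj_on_subset[of _ "{(x, y). x \<in> X \<and> y \<in> X \<and> x \<noteq> y}"])
      (use assms(1) Y(1) in \<open>auto simp: modular_golomb_ruler_def\<close>)
  with Y assms show ?thesis
    by (auto simp: modular_golomb_ruler_def)
qed

text \<open>
  If two differences agree, say \<open>R j - R i \<equiv> R l - R k\<close>, then modulo \<open>p - 1\<close> this gives
  \<open>g ^ j * g ^ k \<equiv> g ^ l * g ^ i\<close>, and modulo \<open>p\<close> it gives \<open>g ^ j + g ^ k \<equiv> g ^ l + g ^ i\<close>. A pair of
  elements of a field is determined up to order by its sum and product,
  so \<open>g ^ i\<close> is one of \<open>g ^ j\<close>, \<open>g ^ k\<close>.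
\<close>
lemma ruzsa_ruler:
  fixes p :: nat
  assumes p: "prime p" and "p \<ge> 5"
  shows "\<exists>X. modular_golomb_ruler (p * (p - 1)) (p - 1) X"
proof -
  have "p > 1" using p prime_gt_1_nat by blast
  obtain g where g: "residue_primroot p g"
    using prime_primitive_root_exists[of p] p \<open>p > 1\<close> by blast
  hence cop: "coprime p g" and ord: "ord p g = p - 1"
    using p by (auto simp: residue_primroot_def totient_prime)
  have pow_cong: "[g ^ i = g ^ j] (mod p) \<longleftrightarrow> [i = j] (mod p - 1)" for i j
    using order_divides_expdiff[OF cop] ord by simp
  have "coprime (p - 1) p"
    by (rule coprime_diff_one_left_nat) (use \<open>p > 1\<close> in simp)
  hence "\<exists>x. x < (p - 1) * p \<and> [x = i] (mod p - 1) \<and> [x = g ^ i] (mod p)" for i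
    using binary_chinese_remainder_unique_nat[of "p - 1" p i "g ^ i"] \<open>p > 1\<close> by auto
  then obtain R where R: "\<And>i. R i < (p - 1) * p" "\<And>i. [R i = i] (mod p - 1)"
      "\<And>i. [R i = g ^ i] (mod p)" by metis
  let ?v = "p * (p - 1)"
  define X where "X = (\<lambda>i. int (R i)) ` {..<p-1}"
  have small: "i = j" if "[i = j] (mod p - 1)" "i < p - 1" "j < p - 1" for i j
    using that by (simp add: cong_def)
  have injR: "inj_on (\<lambda>i. int (R i)) {..<p-1}"
  proof (rule inj_onI)
    fix i j assume "i \<in> {..<p-1}" "j \<in> {..<p-1}" "int (R i) = int (R j)"
    thus "i = j" using R(2)[of i] R(2)[of j] small[of i j]
      by (metis cong_sym cong_trans lessThan_iff of_nat_eq_iff)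
  qed
  have key: "i = k \<and> j = l"
    if ij: "i < p - 1" "j < p - 1" "i \<noteq> j" and kl: "k < p - 1" "l < p - 1"
    and eq: "(int (R j) - int (R i)) mod int ?v = (int (R l) - int (R k)) mod int ?v" for i j k l
  proof -
    have "[int (R j) - int (R i) = int (R l) - int (R k)] (mod int ?v)"
      using eq by (simp only: cong_def)
    hence "[int (R j) - int (R i) + (int (R i) + int (R k)) =
            int (R l) - int (R k) + (int (R i) + int (R k))] (mod int ?v)"
      by (rule cong_add) simp
    hence "[int (R j + R k) = int (R l + R i)] (mod int ?v)" by (simp add: algebra_simps)
    hence c: "[R j + R k = R l + R i] (mod ?v)" by (simp only: cong_int_iff)
    have c1: "[R j + R k = R l + R i] (mod p - 1)" and c2: "[R j + R k = R l + R i] (mod p)"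
      using cong_dvd_modulus_nat[OF c] by auto
    have e1: "[j + k = l + i] (mod p - 1)"
      using c1 cong_add[OF R(2)[of j] R(2)[of k]] cong_add[OF R(2)[of l] R(2)[of i]]
      by (metis cong_sym cong_trans)
    have e2: "[g ^ j + g ^ k = g ^ l + g ^ i] (mod p)"
      using c2 cong_add[OF R(3)[of j] R(3)[of k]] cong_add[OF R(3)[of l] R(3)[of i]]
      by (metis cong_sym cong_trans)
    have e3: "[g ^ j * g ^ k = g ^ l * g ^ i] (mod p)"
      using e1 pow_cong[of "j + k" "l + i"] by (simp add: power_add)
    define G where "G i = int (g ^ i)" for i
    have s: "int p dvd (G j + G k) - (G l + G i)"
      using e2 unfolding G_def cong_iff_dvd_diff[symmetric] of_nat_add[symmetric] cong_int_iff .
    have t: "int p dvd G j * G k - G l * G i"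
      using e3 unfolding G_def cong_iff_dvd_diff[symmetric] of_nat_mult[symmetric] cong_int_iff .
    \<comment> \<open>\<open>G i\<close> is a root modulo \<open>p\<close> of the polynomial with roots \<open>G j\<close> and \<open>G k\<close>.\<close>
    have "(G i - G k) * (G i - G j) =
            (G j * G k - G l * G i) - G i * ((G j + G k) - (G l + G i))"
      by (simp add: algebra_simps)
    also have "int p dvd \<dots>" by (rule dvd_diff[OF t dvd_mult[OF s]])
    finally have "int p dvd G i - G k \<or> int p dvd G i - G j"
      using p by (simp add: prime_dvd_mult_iff)
    hence "[g ^ i = g ^ k] (mod p) \<or> [g ^ i = g ^ j] (mod p)"
      unfolding G_def cong_iff_dvd_diff[symmetric] cong_int_iff .
    hence "i = k" using ij kl small pow_cong by blast
    hence "[j + k = l + k] (mod p - 1)" using e1 by simp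
    hence "j = l" using small ij kl by (simp add: cong_add_rcancel_nat)
    with \<open>i = k\<close> show ?thesis by simp
  qed
  have "inj_on (\<lambda>(x, y). (y - x) mod int ?v) {(x, y). x \<in> X \<and> y \<in> X \<and> x \<noteq> y}"
  proof (rule inj_onI)
    fix a b
    assume a: "a \<in> {(x, y). x \<in> X \<and> y \<in> X \<and> x \<noteq> y}" and b: "b \<in> {(x, y). x \<in> X \<and> y \<in> X \<and> x \<noteq> y}"
      and eq: "(\<lambda>(x, y). (y - x) mod int ?v) a = (\<lambda>(x, y). (y - x) mod int ?v) b"
    obtain i j where ij: "a = (int (R i), int (R j))" "i < p - 1" "j < p - 1" "i \<noteq> j"
      using a unfolding X_def by auto
    obtain k l where kl: "b = (int (R k), int (R l))" "k < p - 1" "l < p - 1" "k \<noteq> l"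
      using b unfolding X_def by auto
    show "a = b" using key[of i j k l] eq ij kl by (simp only: split_conv simp_thms)
  qed
  moreover have "card X = p - 1" unfolding X_def using card_image[OF injR] by simp
  moreover have "X \<subseteq> {0..int ?v - 1}"
  proof -
    have "int (R i) \<le> int ?v - 1" for i using R(1)[of i] by (simp add: mult.commute flip: of_nat_mult)
    thus ?thesis unfolding X_def by auto
  qed
  ultimately have "modular_golomb_ruler ?v (p - 1) X"
    using \<open>p \<ge> 5\<close> by (simp add: modular_golomb_ruler_def)
  thus ?thesis by blast
qed

lemma short_ruler_if_larger_ruler:
  assumes "modular_golomb_ruler v m X" "3 \<le> k" "k \<le> m" "2 * v \<le> 3 * k\<^sup>2"
  shows "\<exists>v::nat. real v \<le> 3 * (real k)\<^sup>2 / 2 \<and> (\<exists>X. modular_golomb_ruler v k X)"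
proof -
  have "real (2 * v) \<le> real (3 * k\<^sup>2)" using assms(4) by (simp only: of_nat_le_iff)
  hence "real v \<le> 3 * (real k)\<^sup>2 / 2" by simp
  thus ?thesis using modular_golomb_ruler_shrink[OF assms(1-3)] by blast
qed

lemma short_ruler_if_prime:
  assumes "prime p" "3 \<le> k" "k < p" "2 * (p * (p - 1)) \<le> 3 * k\<^sup>2"
  shows "\<exists>v::nat. real v \<le> 3 * (real k)\<^sup>2 / 2 \<and> (\<exists>X. modular_golomb_ruler v k X)"
proof -
  have "p \<noteq> 4" using assms(1) by auto
  hence "p \<ge> 5" using assms by linarith
  then obtain X where "modular_golomb_ruler (p * (p - 1)) (p - 1) X"
    using ruzsa_ruler assms(1) by blast
  thus ?thesis by (rule short_ruler_if_larger_ruler) (use assms in auto)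
qed

section \<open>Explicit rulers\<close>

text \<open>
  A sufficient test for distinctness that splits the list as quicksort does. It evaluates with far
  fewer comparisons than comparing all pairs.
\<close>
fun distinct_by_pivots :: "int list \<Rightarrow> bool" where
  "distinct_by_pivots [] \<longleftrightarrow> True"
| "distinct_by_pivots (x # xs) \<longleftrightarrow>
     (let us = filter (\<lambda>y. y < x) xs; vs = filter (\<lambda>y. \<not> y < x) xs
      in list_all (\<lambda>y. x < y) vs \<and> distinct_by_pivots us \<and> distinct_by_pivots vs)"

lemma distinct_if_distinct_by_pivots: "distinct_by_pivots xs \<Longrightarrow> distinct xs"
proof (induction xs rule: distinct_by_pivots.induct)
  case (2 x xs)
  hence *: "list_all (\<lambda>y. x < y) (filter (\<lambda>y. \<not> y < x) xs)"
      "distinct (filter (\<lambda>y. y < x) xs)" "distinct (filter (\<lambda>y. \<not> y < x) xs)"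
    by (simp_all add: Let_def)
  have "x \<notin> set xs" using *(1) by (fastforce simp: list_all_iff)
  moreover have "distinct xs"
  proof (rule ccontr)
    assume "\<not> distinct xs"
    then obtain as bs cs y where xs: "xs = as @ [y] @ bs @ [y] @ cs"
      using not_distinct_decomp by blast
    show False using *(2,3) by (cases "y < x") (auto simp: xs)
  qed
  ultimately show ?case by simp
qed simp

text \<open>An executable sufficient criterion for the list \<open>xs\<close> to enumerate a ruler modulo \<open>v\<close>.\<close>
definition golomb_check :: "int \<Rightarrow> int list \<Rightarrow> bool" where
  "golomb_check v xs \<longleftrightarrow> list_all (\<lambda>x. 0 \<le> x \<and> x < v) xs \<and> distinct_by_pivots xs \<and>
    distinct_by_pivots
      (map (\<lambda>(x, y). (y - x) mod v) (filter (\<lambda>(x, y). x \<noteq> y) (List.product xs xs)))"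

lemma modular_golomb_ruler_if_check:
  assumes "golomb_check (int v) xs" "v > 0" "length xs = k" "k \<ge> 3"
  shows "modular_golomb_ruler v k (set xs)"
proof -
  have "set (filter (\<lambda>(x, y). x \<noteq> y) (List.product xs xs)) =
      {(x, y). x \<in> set xs \<and> y \<in> set xs \<and> x \<noteq> y}" by auto
  with assms show ?thesis
    by (auto simp: golomb_check_def modular_golomb_ruler_def distinct_map distinct_card list_all_iff
        dest!: distinct_if_distinct_by_pivots)
qed

lemma ruler_7: "modular_golomb_ruler 7 3 (set
     [0, 1, 3])"
  by (rule modular_golomb_ruler_if_check, code_simp) simp_all

lemma ruler_31: "modular_golomb_ruler 31 6 (set
     [0, 1, 3, 8, 12, 18])"
  by (rule modular_golomb_ruler_if_check, code_simp) simp_all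

lemma ruler_57: "modular_golomb_ruler 57 8 (set
     [0, 1, 3, 13, 32, 36, 43, 52])"
  by (rule modular_golomb_ruler_if_check, code_simp) simp_all

lemma ruler_183: "modular_golomb_ruler 183 14 (set
     [0, 1, 3, 16, 23, 28, 42, 76, 82, 86, 119, 137, 154, 175])"
  by (rule modular_golomb_ruler_if_check, code_simp) simp_all

lemma ruler_553: "modular_golomb_ruler 553 24 (set
     [0, 1, 3, 13, 41, 61, 85, 90, 94, 115, 137, 201, 207, 238, 246, 257, 264, 280, 326, 385,
      421, 456, 488, 539])"
  by (rule modular_golomb_ruler_if_check, code_simp) simp_all

section \<open>Chebyshev's bounds for primes\<close>

lemma ln_fact_eq_sum_mangoldt:
  "ln (fact n :: real) = (\<Sum>d=1..n. mangoldt d * real (n div d))"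
proof (induction n)
  case (Suc n)
  have "(\<Sum>d=1..Suc n. mangoldt d * real (Suc n div d)) =
        (\<Sum>d=1..Suc n. mangoldt d * real (n div d) + (if d dvd Suc n then mangoldt d else 0))"
    by (intro sum.cong refl) (auto simp: div_Suc dvd_eq_mod_eq_0 algebra_simps)
  also have "\<dots> = (\<Sum>d=1..Suc n. mangoldt d * real (n div d)) + (\<Sum>d | d dvd Suc n. mangoldt d)"
    unfolding sum.distrib
  proof (rule arg_cong2[where f = "(+)"])
    have "{d. d dvd Suc n} = {d \<in> {1..Suc n}. d dvd Suc n}"
      using dvd_imp_le[of _ "Suc n"] by (auto simp: Suc_le_eq intro!: Nat.gr0I)
    thus "(\<Sum>d=1..Suc n. if d dvd Suc n then mangoldt d else 0) =
        (\<Sum>d | d dvd Suc n. mangoldt d :: real)"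
      by (simp only: sum.inter_filter[OF finite_atLeastAtMost])
  qed simp
  also have "(\<Sum>d | d dvd Suc n. mangoldt d) = ln (real (Suc n))"
    using mangoldt_sum[of "Suc n", where ?'a = real] by simp
  finally show ?case using Suc by (simp add: ln_mult add.commute del: of_nat_Suc)
qed simp

lemma ln_fact_div_eq_sum_mangoldt:
  assumes "a > 0"
  shows "ln (fact (n div a) :: real) = (\<Sum>d=1..n. mangoldt d * real (n div d div a))"
proof -
  have "(\<Sum>d=1..n. mangoldt d * real (n div d div a)) =
        (\<Sum>d=1..n div a. mangoldt d * real (n div d div a))"
  proof (rule sum.mono_neutral_right)
    show "\<forall>d\<in>{1..n} - {1..n div a}. mangoldt d * real (n div d div a) = 0"
    proof
      fix d assume "d \<in> {1..n} - {1..n div a}"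
      hence "n div a < d" by auto
      hence "n div a div d = 0" by simp
      thus "mangoldt d * real (n div d div a) = 0"
        by (simp add: div_mult2_eq[symmetric] mult.commute)
    qed
  qed auto
  also have "\<dots> = ln (fact (n div a))"
    unfolding ln_fact_eq_sum_mangoldt
    by (intro sum.cong refl) (simp add: div_mult2_eq[symmetric] mult.commute)
  finally show ?thesis by simp
qed

text \<open>The second Chebyshev function \<open>\<psi>\<close>, at natural arguments.\<close>
definition chebyshev_psi :: "nat \<Rightarrow> real" where
  "chebyshev_psi n = (\<Sum>d=1..n. mangoldt d)"

text \<open>
  The logarithm of Chebyshev's factorial quotient. The signed reciprocals of the divisors
  \<open>1, 30, 2, 3, 5\<close> sum to zero, which cancels the terms of order \<open>n ln n\<close>.
\<close>
definition chebyshev_ln :: "nat \<Rightarrow> real" where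
  "chebyshev_ln n = ln (fact n) + ln (fact (n div 30))
     - ln (fact (n div 2)) - ln (fact (n div 3)) - ln (fact (n div 5))"

text \<open>The coefficient of \<open>mangoldt d\<close> in \<open>chebyshev_ln n\<close>, as a function of \<open>m = n div d\<close>.\<close>
definition chebyshev_weight :: "nat \<Rightarrow> real" where
  "chebyshev_weight m = real m + real (m div 30) - real (m div 2) - real (m div 3) - real (m div 5)"

lemma chebyshev_ln_eq_sum:
  "chebyshev_ln n = (\<Sum>d=1..n. mangoldt d * chebyshev_weight (n div d))"
  unfolding chebyshev_ln_def chebyshev_weight_def
  by (simp add: ln_fact_eq_sum_mangoldt[of n] ln_fact_div_eq_sum_mangoldt
      algebra_simps sum.distrib sum_subtractf)

lemma chebyshev_weight_cases:
  "chebyshev_weight m = 0 \<or> chebyshev_weight m = 1"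
proof -
  define q r where "q = m div 30" and "r = m mod 30"
  have m: "m = 30 * q + r" and "r < 30" by (simp_all add: q_def r_def)
  have div_eq: "m div 2 = 15 * q + r div 2" "m div 3 = 10 * q + r div 3" "m div 5 = 6 * q + r div 5"
    unfolding m by presburger+
  have "\<forall>r\<in>set [0..<30::nat].
      r = r div 2 + r div 3 + r div 5 \<or> r = r div 2 + r div 3 + r div 5 + 1"
    by code_simp
  hence cases_r: "r = r div 2 + r div 3 + r div 5 \<or> r = r div 2 + r div 3 + r div 5 + 1"
    using \<open>r < 30\<close> by simp
  have "m + m div 30 = m div 2 + m div 3 + m div 5 \<or>
        m + m div 30 = m div 2 + m div 3 + m div 5 + 1"
    unfolding div_eq q_def[symmetric] using cases_r m by (elim disjE) linarith+
  hence "real (m + m div 30) = real (m div 2 + m div 3 + m div 5) \<or>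
        real (m + m div 30) = real (m div 2 + m div 3 + m div 5 + 1)"
    by (simp only: of_nat_eq_iff)
  thus ?thesis by (auto simp: chebyshev_weight_def)
qed

lemma chebyshev_weight_eq_1:
  assumes "0 < m" "m < 6"
  shows "chebyshev_weight m = 1"
proof -
  have "m \<in> {1, 2, 3, 4, 5}" using assms by auto
  thus ?thesis by (auto simp: chebyshev_weight_def)
qed

lemma chebyshev_ln_le_psi: "chebyshev_ln n \<le> chebyshev_psi n"
  unfolding chebyshev_ln_eq_sum chebyshev_psi_def
proof (intro sum_mono)
  fix d show "mangoldt d * chebyshev_weight (n div d) \<le> mangoldt d"
    using chebyshev_weight_cases[of "n div d"] mangoldt_nonneg[of d] by auto
qed

text \<open>The weight is \<open>1\<close> for all \<open>d\<close> in the range \<open>n div 6 < d \<le> n\<close>, as then \<open>1 \<le> n div d \<le> 5\<close>.\<close>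
lemma psi_le_chebyshev_ln: "chebyshev_psi n \<le> chebyshev_psi (n div 6) + chebyshev_ln n"
proof -
  have "chebyshev_psi n = chebyshev_psi (n div 6) + (\<Sum>d\<in>{n div 6<..n}. mangoldt d)"
    unfolding chebyshev_psi_def
    by (subst sum.union_disjoint[symmetric]) (auto intro!: sum.cong)
  also have "(\<Sum>d\<in>{n div 6<..n}. mangoldt d) =
      (\<Sum>d\<in>{n div 6<..n}. mangoldt d * chebyshev_weight (n div d))"
  proof (intro sum.cong refl)
    fix d assume d: "d \<in> {n div 6<..n}"
    hence "n < 6 * d" by auto
    hence "n div d < 6" using d by (simp add: less_mult_imp_div_less)
    moreover have "0 < n div d" using d by (auto simp: div_greater_zero_iff)
    ultimately show "mangoldt d = mangoldt d * chebyshev_weight (n div d)"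
      by (simp add: chebyshev_weight_eq_1)
  qed
  also have "\<dots> \<le> (\<Sum>d\<in>{1..n}. mangoldt d * chebyshev_weight (n div d))"
  proof (intro sum_mono2)
    fix d show "0 \<le> mangoldt d * chebyshev_weight (n div d)"
      using chebyshev_weight_cases[of "n div d"] mangoldt_nonneg[of d] by auto
  qed auto
  finally show ?thesis by (simp add: chebyshev_ln_eq_sum)
qed

text \<open>An antiderivative of the natural logarithm on the positive reals.\<close>
definition xlnx :: "real \<Rightarrow> real" where "xlnx x = x * ln x - x"

lemma xlnx_diff_le:
  assumes "0 < a" "0 < b"
  shows "xlnx b - xlnx a \<le> (b - a) * ln b"
proof -
  have "ln (b / a) \<le> b / a - 1" using assms by (intro ln_le_minus_one) auto
  hence "a * (ln b - ln a) \<le> b - a"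
    using assms by (simp add: ln_div field_simps)
  thus ?thesis by (simp add: xlnx_def algebra_simps)
qed

lemma ln_fact_bounds:
  assumes "0 < m"
  shows "xlnx (real m) + 1 \<le> ln (fact m) \<and> ln (fact m) \<le> xlnx (real m) + 1 + ln (real m)"
  using assms
proof (induction m rule: nat_induct_non_zero)
  case 1 show ?case by (simp add: xlnx_def)
next
  case (Suc m)
  have "ln (fact (Suc m) :: real) = ln (real (Suc m)) + ln (fact m)"
    by (simp add: ln_mult del: of_nat_Suc)
  thus ?case
    using Suc xlnx_diff_le[of "real m" "real (Suc m)"] xlnx_diff_le[of "real (Suc m)" "real m"]
    by simp
qed

lemma ln_fact_div_bounds:
  assumes "0 < a" "a \<le> n"
  shows "\<bar>ln (fact (n div a)) - (xlnx (real n / real a) + 1)\<bar> \<le> ln (real n / real a)"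
proof -
  define m where "m = n div a"
  define x where "x = real n / real a"
  have "0 < m" using assms by (simp add: m_def div_greater_zero_iff)
  have mx: "real m \<le> x" unfolding m_def x_def by (rule of_nat_div_le_of_nat)
  have "n < (m + 1) * a" using assms dividend_less_div_times[of a n] by (simp add: m_def algebra_simps)
  hence "real n < (real m + 1) * real a"
    by (metis of_nat_1 of_nat_add of_nat_less_iff of_nat_mult)
  hence xm: "x < real m + 1" using assms by (simp add: x_def field_simps)
  have "1 \<le> real m" using \<open>0 < m\<close> by simp
  hence pos: "0 < real m" "1 \<le> x" "0 < x" using mx by linarith+
  have l: "0 \<le> ln (real m)" "ln (real m) \<le> ln x" using mx pos \<open>1 \<le> real m\<close> by auto
  have "xlnx x - xlnx (real m) \<le> (x - real m) * ln x" by (rule xlnx_diff_le) (use pos in auto)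
  also have "\<dots> \<le> 1 * ln x" using xm l by (intro mult_right_mono) auto
  finally have 1: "xlnx x - xlnx (real m) \<le> ln x" by simp
  have "xlnx (real m) - xlnx x \<le> (real m - x) * ln (real m)"
    by (rule xlnx_diff_le) (use pos in auto)
  also have "\<dots> \<le> 0" using mx l by (simp add: mult_nonpos_nonneg)
  finally have 2: "xlnx (real m) \<le> xlnx x" by simp
  show ?thesis
    using 1 2 l ln_fact_bounds[OF \<open>0 < m\<close>] unfolding m_def[symmetric] x_def[symmetric]
    by linarith
qed

text \<open>Chebyshev's constant \<open>A = 0.92129...\<close>\<close>
definition chebyshev_const :: real where
  "chebyshev_const = ln 2 / 2 + ln 3 / 3 + ln 5 / 5 - ln 30 / 30"

lemma chebyshev_const_ge: "chebyshev_const \<ge> 4 / 5"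
proof -
  have l30: "ln 30 = ln 2 + ln 3 + ln (5 :: real)"
    using ln_mult[of 6 "5 :: real"] ln_mult[of 2 "3 :: real"] by simp
  have "ln (4::real) = 2 * ln 2" using ln_realpow[of "2::real" 2] by simp
  hence l5: "ln 5 \<ge> 2 * ln (2::real)" using ln_le_cancel_iff[of 4 "5::real"] by simp
  have "exp 1 \<le> (3 :: real)" by (rule exp_le)
  hence l3: "ln 3 \<ge> (1::real)" by (simp add: ln_ge_iff)
  show ?thesis unfolding chebyshev_const_def l30 add_divide_distrib using l5 l3 ln2_ge_two_thirds by linarith
qed

lemma chebyshev_ln_approx:
  assumes "n \<ge> 30"
  shows "\<bar>chebyshev_ln n - chebyshev_const * real n\<bar> \<le> 5 * ln (real n)"
proof -
  define L where "L = ln (real n)"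
  have n: "0 < real n" using assms by simp
  have ln_div': "ln (real n / c) = L - ln c" if "c > 0" for c
    using n that by (simp add: ln_div L_def)
  have x: "xlnx (real n / c) = real n / c * (L - ln c) - real n / c" if "c > 0" for c
    using that by (simp add: xlnx_def ln_div')
  have "(1::real) \<le> ln 3" using exp_le by (simp add: ln_ge_iff)
  hence "(1 :: real) \<le> ln 30 + ln 2 + ln 3 + ln 5"
    using ln_ge_zero[of "30::real"] ln_ge_zero[of "2::real"] ln_ge_zero[of "5::real"] by linarith
  moreover note ln_fact_div_bounds[of 1 n] ln_fact_div_bounds[of 30 n] ln_fact_div_bounds[of 2 n]
    ln_fact_div_bounds[of 3 n] ln_fact_div_bounds[of 5 n]
  moreover have "xlnx (real n) + xlnx (real n / 30) - xlnx (real n / 2) - xlnx (real n / 3)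
      - xlnx (real n / 5) = chebyshev_const * real n"
    using x[of 1] by (simp add: x chebyshev_const_def field_simps)
  ultimately have "\<bar>chebyshev_ln n - chebyshev_const * real n + 1\<bar> \<le>
      5 * L - (ln 30 + ln 2 + ln 3 + ln 5)" "1 \<le> ln 30 + ln 2 + ln 3 + ln (5 :: real)"
    using assms by (simp_all add: chebyshev_ln_def ln_div' abs_le_iff flip: L_def)
  thus ?thesis unfolding L_def by linarith
qed

lemma psi_ge:
  assumes "n \<ge> 30"
  shows "chebyshev_psi n \<ge> chebyshev_const * real n - 5 * ln (real n)"
  using chebyshev_ln_approx[OF assms] chebyshev_ln_le_psi[of n] by linarith

text \<open>
  Iterating \<open>\<psi>(n) \<le> \<psi>(n div 6) + A n + 5 ln n\<close> sums the geometric series \<open>A n (1 + 1/6 + ...)\<close>.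
  The logarithmic errors are absorbed in the square term because
  \<open>3 (L - 1)\<^sup>2 + 5 L \<le> 3 L\<^sup>2\<close> for \<open>L \<ge> 3\<close>, and \<open>900\<close> covers the start of the induction \<open>n < 30\<close>.
\<close>
lemma psi_le:
  assumes "n \<ge> 1"
  shows "chebyshev_psi n \<le> 6 / 5 * chebyshev_const * real n + 3 * ln (real n) ^ 2 + 900"
  using assms
proof (induction n rule: less_induct)
  case (less n)
  show ?case
  proof (cases "n < 30")
    case True
    have "chebyshev_psi n \<le> (\<Sum>d=1..n. 30)"
      unfolding chebyshev_psi_def
    proof (intro sum_mono)
      fix d assume d: "d \<in> {1..n}"
      have "mangoldt d \<le> ln (real d)" using mangoldt_le[of d] d by simp
      also have "\<dots> \<le> real d - 1" using d by (intro ln_le_minus_one) auto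
      finally show "mangoldt d \<le> (30::real)" using d True by simp
    qed
    hence "chebyshev_psi n \<le> 900" using True by simp
    moreover have "0 \<le> 6 / 5 * chebyshev_const * real n" using chebyshev_const_ge by simp
    ultimately show ?thesis by (smt (verit) zero_le_power2)
  next
    case False
    define m where "m = n div 6"
    define L where "L = ln (real n)"
    have m: "1 \<le> m" "m < n" "real m \<le> real n / 6"
      using False unfolding m_def by (auto intro: order_trans[OF of_nat_div_le_of_nat])
    have "exp 1 ^ 3 \<le> (3 :: real) ^ 3" using exp_le by (intro power_mono) auto
    hence "exp 3 \<le> (30 :: real)" by (simp flip: exp_of_nat_mult)
    hence L: "3 \<le> L" using False by (simp add: L_def ln_ge_iff)
    have "ln (real m) \<le> ln (real n / 6)" using m by simp
    also have "\<dots> = L - ln 6" using m by (simp add: L_def ln_div)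
    also have "\<dots> \<le> L - 1" using exp_le by (simp add: ln_ge_iff)
    finally have "ln (real m) \<le> L - 1" .
    hence "ln (real m) ^ 2 \<le> (L - 1) ^ 2" using m by (intro power_mono) auto
    hence "3 * ln (real m) ^ 2 + 5 * L \<le> 3 * L ^ 2" using L by (simp add: power2_eq_square algebra_simps)
    moreover have "6 / 5 * chebyshev_const * real m \<le> 6 / 5 * chebyshev_const * (real n / 6)"
      using m chebyshev_const_ge by (intro mult_left_mono) auto
    moreover have "chebyshev_psi n \<le> chebyshev_psi m + (chebyshev_const * real n + 5 * L)"
      using psi_le_chebyshev_ln[of n] chebyshev_ln_approx[of n] False by (simp add: m_def L_def)
    moreover have "chebyshev_psi m \<le> 6 / 5 * chebyshev_const * real m + 3 * ln (real m) ^ 2 + 900"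
      by (rule less.IH) (use m in auto)
    ultimately show ?thesis unfolding L_def[symmetric] by linarith
  qed
qed

text \<open>
  Only proper prime powers \<open>p ^ k \<in> {x<..y}\<close> contribute. Their bases are at most \<open>\<surd>y\<close>, and since
  \<open>y < 2 x\<close> each base contributes at most one power.
\<close>
lemma psi_diff_le_if_no_primes:
  assumes y: "y < 2 * x" and no: "\<And>p. prime p \<Longrightarrow> \<not> (x < p \<and> p \<le> y)"
  shows "chebyshev_psi y - chebyshev_psi x \<le> sqrt (real y) * ln (sqrt (real y))"
proof (cases "x \<le> y")
  case False
  hence "chebyshev_psi y \<le> chebyshev_psi x"
    unfolding chebyshev_psi_def by (intro sum_mono2) (auto simp: mangoldt_nonneg)
  moreover have "0 \<le> sqrt (real y) * ln (sqrt (real y))"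
    by (cases "y = 0") auto
  ultimately show ?thesis by linarith
next
  case True
  define u where "u = sqrt (real y)"
  define S where "S = {d. primepow d \<and> x < d \<and> d \<le> y}"
  have "finite S" unfolding S_def by (rule finite_subset[of _ "{..y}"]) auto
  have "chebyshev_psi y = chebyshev_psi x + (\<Sum>d\<in>{x<..y}. mangoldt d)"
    unfolding chebyshev_psi_def using True
    by (subst sum.union_disjoint[symmetric]) (auto intro!: sum.cong)
  also have "(\<Sum>d\<in>{x<..y}. mangoldt d :: real) = (\<Sum>d\<in>S. mangoldt d)"
    by (rule sum.mono_neutral_right) (auto simp: S_def mangoldt_def)
  finally have psi: "chebyshev_psi y - chebyshev_psi x = (\<Sum>d\<in>S. mangoldt d)" by simp
  have decomp: "\<exists>p k. prime p \<and> k \<ge> 2 \<and> d = p ^ k \<and> aprimedivisor d = p \<and> p\<^sup>2 \<le> y"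
    if "d \<in> S" for d
  proof -
    from that obtain p k where p: "prime p" "k > 0" "d = p ^ k"
      unfolding S_def primepow_def by blast
    have "k \<noteq> 1" using no[of p] p that by (auto simp: S_def)
    hence "k \<ge> 2" using p by simp
    have "p\<^sup>2 \<le> p ^ k" using \<open>k \<ge> 2\<close> p prime_gt_0_nat[of p] by (intro power_increasing) auto
    also have "\<dots> \<le> y" using that p by (simp add: S_def)
    finally show ?thesis using p \<open>k \<ge> 2\<close> by (auto simp: aprimedivisor_prime_power)
  qed
  have "inj_on aprimedivisor S"
  proof (rule inj_onI)
    fix d e assume de: "d \<in> S" "e \<in> S" "aprimedivisor d = aprimedivisor e"
    then obtain p i j where p: "prime p" "d = p ^ i" "e = p ^ j"
      using decomp[of d] decomp[of e] by metis
    have "p \<ge> 2" using p prime_ge_2_nat by blast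
    have *: False if "p ^ a \<in> S" "p ^ b \<in> S" "a < b" for a b
    proof -
      have "2 * p ^ a \<le> p ^ Suc a" using \<open>p \<ge> 2\<close> by simp
      also have "\<dots> \<le> p ^ b" using that \<open>p \<ge> 2\<close> by (intro power_increasing) auto
      finally show False using that y by (auto simp: S_def)
    qed
    show "d = e" using *[of i j] *[of j i] de p by (metis nat_neq_iff)
  qed
  moreover have "aprimedivisor ` S \<subseteq> {1..nat \<lfloor>u\<rfloor>}"
  proof safe
    fix d assume "d \<in> S"
    then obtain p where p: "prime p" "aprimedivisor d = p" "p\<^sup>2 \<le> y" using decomp by blast
    have "real p ^ 2 \<le> real y" using p(3) by (metis of_nat_le_iff of_nat_power)
    hence "real p \<le> u" unfolding u_def by (rule real_le_rsqrt)
    thus "aprimedivisor d \<in> {1..nat \<lfloor>u\<rfloor>}" using p prime_ge_1_nat[of p] by (simp add: le_nat_floor)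
  qed
  ultimately have "card S \<le> card {1..nat \<lfloor>u\<rfloor>}" by (metis card_image card_mono finite_atLeastAtMost)
  hence "real (card S) \<le> real (nat \<lfloor>u\<rfloor>)" by simp
  also have "\<dots> \<le> u" by (simp add: u_def)
  finally have card: "real (card S) \<le> u" .
  have "(\<Sum>d\<in>S. mangoldt d) \<le> (\<Sum>d\<in>S. ln u)"
  proof (rule sum_mono)
    fix d assume "d \<in> S"
    then obtain p k where p: "prime p" "k \<ge> 2" "d = p ^ k" "p\<^sup>2 \<le> y" using decomp by blast
    have "real p ^ 2 \<le> real y" using p(4) by (metis of_nat_le_iff of_nat_power)
    hence "real p \<le> u" unfolding u_def by (rule real_le_rsqrt)
    moreover have "0 < real p" using p prime_gt_0_nat by simp
    ultimately show "mangoldt d \<le> ln u" using p by (simp add: mangoldt_primepow)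
  qed
  also have "\<dots> = real (card S) * ln u" by simp
  also have "\<dots> \<le> u * ln u"
  proof (cases "y = 0")
    case False
    hence "0 \<le> ln u" by (simp add: u_def)
    thus ?thesis using card by (intro mult_right_mono)
  qed (use card in \<open>simp add: u_def\<close>)
  finally show ?thesis using psi by (simp add: u_def)
qed

lemma prime_between:
  fixes x :: nat
  assumes x: "x \<ge> 1000000"
  shows "\<exists>p. prime p \<and> x < p \<and> 50 * p \<le> 61 * x"
proof (rule ccontr)
  assume *: "\<not> ?thesis"
  define y where "y = 61 * x div 50"
  define u where "u = sqrt (real y)"
  have no: "\<not> (x < p \<and> p \<le> y)" if "prime p" for p
    using * that unfolding y_def by (auto simp: less_eq_div_iff_mult_less_eq mult.commute)
  have "61 * x < 50 * (y + 1)" "x \<le> y" "y < 2 * x" unfolding y_def using x by simp_all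
  hence y: "61 * real x \<le> 50 * (real y + 1)" "real x \<le> real y" "1000000 \<le> real y"
    using x of_nat_mono[of "61 * x" "50 * (y + 1)", where ?'a = real] by simp_all
  have uu: "u * u = real y" by (simp add: u_def)
  have u: "1000 \<le> u" unfolding u_def using y by (intro real_le_rsqrt) simp
  \<comment> \<open>The tangent to \<open>ln\<close> at \<open>1000\<close>, a lower bound for \<open>u\<close>, gives a linear bound for \<open>ln u\<close>.\<close>
  have "ln (1000::real) \<le> 7"
  proof -
    have "ln (1000::real) \<le> ln (2 ^ 10)" by simp
    also have "\<dots> = 10 * ln 2" by (subst ln_realpow) auto
    finally show ?thesis using ln2_le_25_over_36 by simp
  qed
  moreover have "ln (u / 1000) \<le> u / 1000 - 1" using u by (intro ln_le_minus_one) auto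
  ultimately have lu: "ln u \<le> 6 + u / 1000" using u by (simp add: ln_div)
  have ly: "ln (real y) = 2 * ln u" using y by (simp add: u_def ln_sqrt)
  have "ln (real x) \<le> ln (real y)" using x y by simp
  hence lx: "ln (real x) \<le> 2 * ln u" "0 \<le> ln (real x)" using ly x by simp_all
  have u1: "1000 * u \<le> real y" using u by (simp flip: uu)
  have "u * ln u \<le> u * (6 + u / 1000)" using lu u by (intro mult_left_mono) linarith+
  also have "\<dots> = 6 * u + u * u / 1000" by (simp add: field_simps)
  finally have b1: "u * ln u \<le> 6 * u + real y / 1000" unfolding uu .
  have "ln (real x) ^ 2 \<le> (12 + u / 500) ^ 2" using lx lu by (intro power_mono) linarith+
  also have "\<dots> = 144 + 48 * u / 1000 + 4 * (u * u) / 1000000"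
    by (simp add: power2_eq_square field_simps)
  finally have b2: "ln (real x) ^ 2 \<le> 144 + 48 * u / 1000 + 4 * real y / 1000000" unfolding uu .
  have "chebyshev_const * real y - 5 * ln (real y) \<le> chebyshev_psi y"
    using x \<open>x \<le> y\<close> by (intro psi_ge) auto
  moreover have "chebyshev_psi x \<le> 6 / 5 * chebyshev_const * real x + 3 * ln (real x) ^ 2 + 900"
    using x by (intro psi_le) auto
  moreover have "chebyshev_psi y - chebyshev_psi x \<le> u * ln u"
    unfolding u_def using \<open>y < 2 * x\<close> no by (rule psi_diff_le_if_no_primes)
  moreover have "4 / 5 * (real y - 6 / 5 * real x) \<le> chebyshev_const * (real y - 6 / 5 * real x)"
    using chebyshev_const_ge y by (intro mult_right_mono) auto
  ultimately show False using b1 b2 ly lu u1 y u by (simp add: algebra_simps)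
qed

section \<open>Chains of primes\<close>

text \<open>
  \<open>no_odd_divisor_from d n\<close> tests the candidates \<open>d, d + 2, d + 4, ...\<close> with square at most \<open>n\<close>.
  Integers are used, rather than natural numbers, because they evaluate in binary.
\<close>
function no_odd_divisor_from :: "int \<Rightarrow> int \<Rightarrow> bool" where
  "no_odd_divisor_from d n \<longleftrightarrow>
     (if n < d * d then True else n mod d \<noteq> 0 \<and> no_odd_divisor_from (d + 2) n)"
  by auto
termination
proof (relation "measure (\<lambda>(d, n). nat (n + 1 - d))")
  fix d n :: int assume "\<not> n < d * d"
  moreover have "d \<le> d * d" by (cases "d \<le> 0") (auto intro: order_trans[of d 0])
  ultimately show "((d + 2, n), (d, n)) \<in> measure (\<lambda>(d, n). nat (n + 1 - d))" by auto
qed simp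

\<comment> \<open>Its own right-hand side contains an instance of the left-hand side, so rewriting would loop.\<close>
declare no_odd_divisor_from.simps[simp del]

lemma no_odd_divisor_fromD:
  assumes "no_odd_divisor_from d n" "odd d" "odd q" "d \<le> q" "0 < d" "q * q \<le> n"
  shows "\<not> q dvd n"
  using assms
proof (induction d n rule: no_odd_divisor_from.induct)
  case (1 d n)
  have "d * d \<le> q * q" using 1 by (intro mult_mono) auto
  hence n: "\<not> n < d * d" using 1 by linarith
  with 1 have *: "n mod d \<noteq> 0" "no_odd_divisor_from (d + 2) n"
    by (simp_all add: no_odd_divisor_from.simps[of d n])
  show ?case
  proof (cases "q = d")
    case True
    thus ?thesis using * by auto
  next
    case False
    hence "d + 2 \<le> q" using 1 by presburger
    thus ?thesis using 1 n * by simp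
  qed
qed

text \<open>A sufficient test, by trial division, for an integer to be an odd prime.\<close>
definition passes_trial_division :: "int \<Rightarrow> bool" where
  "passes_trial_division n \<longleftrightarrow> 1 < n \<and> n mod 2 \<noteq> 0 \<and> no_odd_divisor_from 3 n"

lemma prime_if_passes_trial_division:
  assumes "passes_trial_division (int n)"
  shows "prime n"
proof -
  have n: "1 < n" "odd n" "no_odd_divisor_from 3 (int n)"
    using assms by (auto simp: passes_trial_division_def even_iff_mod_2_eq_zero) presburger+
  show ?thesis
    unfolding prime_prime_factor_sqrt[of n]
  proof (intro conjI notI)
    assume "\<exists>p. prime p \<and> p dvd n \<and> p\<^sup>2 \<le> n"
    then obtain p where p: "prime p" "p dvd n" "p\<^sup>2 \<le> n" by blast
    hence "odd p" using n dvd_trans by blast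
    moreover have "p \<ge> 2" using p prime_ge_2_nat by blast
    ultimately have "3 \<le> p" by presburger
    have "int p * int p \<le> int n" using p(3) by (simp add: power2_eq_square flip: of_nat_mult)
    with no_odd_divisor_fromD[OF n(3), of "int p"] \<open>odd p\<close> \<open>3 \<le> p\<close> p(2)
    show False by simp
  qed (use n in auto)
qed

text \<open>
  Each member \<open>p\<close> of a chain serves all \<open>k\<close> from its predecessor \<open>a\<close> up to \<open>p - 1\<close>; the inequality
  is required at the least of these, \<open>k = a\<close>.
\<close>
fun prime_chain :: "int \<Rightarrow> int list \<Rightarrow> bool" where
  "prime_chain a [] \<longleftrightarrow> True"
| "prime_chain a (p # ps) \<longleftrightarrow>
     passes_trial_division p \<and> 2 * (p * (p - 1)) \<le> 3 * (a * a) \<and> prime_chain p ps"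

lemma prime_chainD:
  assumes "prime_chain (int a) ps" "a \<le> k" "int k < last (int a # ps)"
  shows "\<exists>p. prime p \<and> k < p \<and> 2 * (p * (p - 1)) \<le> 3 * k\<^sup>2"
  using assms
proof (induction ps arbitrary: a)
  case (Cons r ps)
  have "1 < r" using Cons.prems(1) by (simp add: passes_trial_division_def)
  define p where "p = nat r"
  have r: "r = int p" "1 < p" using \<open>1 < r\<close> by (auto simp: p_def)
  show ?case
  proof (cases "k < p")
    case True
    have "a * a \<le> k * k" using Cons.prems(2) by (intro mult_mono) auto
    moreover have "int (2 * (p * (p - 1))) \<le> int (3 * (a * a))"
      using Cons.prems(1) r by (simp add: of_nat_diff)
    hence "2 * (p * (p - 1)) \<le> 3 * (a * a)" by (simp only: of_nat_le_iff)
    ultimately have "2 * (p * (p - 1)) \<le> 3 * k\<^sup>2" by (simp only: power2_eq_square)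
    moreover have "prime p"
      using Cons.prems(1) r by (intro prime_if_passes_trial_division) simp
    ultimately show ?thesis using True by blast
  next
    case False
    thus ?thesis using Cons.prems r by (intro Cons.IH[of p]) auto
  qed
qed auto

lemma prime_chains:
  "prime_chain 4 [5]" "prime_chain 6 [7]" "prime_chain 9 [11, 13]" "prime_chain 14 [17, 19, 23]"
  "prime_chain 24
     [29, 31, 37, 43, 53, 61, 73, 89, 109, 131, 157, 191, 233, 283, 347, 421, 509, 619, 757,
      919, 1123, 1373, 1669, 2039, 2477, 3023, 3701, 4523, 5531, 6763, 8273, 10111, 12379,
      15161, 18553, 22721, 27827, 34061, 41687, 51047, 62507, 76543, 93739, 114799, 140593,
      172181, 210869, 258253, 316291, 387371, 474413, 581029, 711589, 871513, 1067371]"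
  by code_simp+

lemma prime_for_small_ruler:
  fixes k :: nat
  assumes "k \<in> {4, 6} \<union> {9..12} \<union> {14..22} \<union> {24..<1000000}"
  shows "\<exists>p. prime p \<and> k < p \<and> 2 * (p * (p - 1)) \<le> 3 * k\<^sup>2"
proof -
  consider "k = 4" | "k = 6" | "k \<in> {9..12}" | "k \<in> {14..22}" | "k \<in> {24..<1000000}"
    using assms by blast
  thus ?thesis
  proof cases
    case 1 thus ?thesis using prime_chainD[of 4 "[5]" k] prime_chains by simp
  next
    case 2 thus ?thesis using prime_chainD[of 6 "[7]" k] prime_chains by simp
  next
    case 3 thus ?thesis using prime_chainD[of 9 "[11, 13]" k] prime_chains by simp
  next
    case 4 thus ?thesis using prime_chainD[of 14 "[17, 19, 23]" k] prime_chains by simp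
  next
    case 5 thus ?thesis using prime_chainD[of 24 _ k, simplified, OF prime_chains(5)] by simp
  qed
qed

section \<open>Short rulers\<close>

theorem theorem2p5:
  fixes k :: nat
  assumes "k \<ge> 3"
  shows "\<exists>v::nat. real v \<le> 3 * (real k)\<^sup>2 / 2 \<and> (\<exists>X. modular_golomb_ruler v k X)"
proof -
  consider "k = 3" | "k = 5" | "k = 7 \<or> k = 8" | "k = 13" | "k = 23" | "k \<ge> 1000000"
    | "k \<in> {4, 6} \<union> {9..12} \<union> {14..22} \<union> {24..<1000000}"
    using assms by (simp, linarith)
  thus ?thesis
  proof cases
    case 1 thus ?thesis by (intro short_ruler_if_larger_ruler[OF ruler_7]) auto
  next
    case 2 thus ?thesis by (intro short_ruler_if_larger_ruler[OF ruler_31]) auto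
  next
    case 3 thus ?thesis by (intro short_ruler_if_larger_ruler[OF ruler_57]) auto
  next
    case 4 thus ?thesis by (intro short_ruler_if_larger_ruler[OF ruler_183]) auto
  next
    case 5 thus ?thesis by (intro short_ruler_if_larger_ruler[OF ruler_553]) auto
  next
    case 6
    then obtain p where p: "prime p" "k < p" "50 * p \<le> 61 * k" using prime_between by blast
    \<comment> \<open>\<open>2 (61/50)\<^sup>2 = 7442/2500 < 3\<close>\<close>
    have "(50 * p) * (50 * p) \<le> (61 * k) * (61 * k)" by (intro mult_le_mono p(3))
    hence "2 * (p * p) \<le> 3 * k\<^sup>2" by (simp add: power2_eq_square)
    moreover have "p * (p - 1) \<le> p * p" by simp
    ultimately have "2 * (p * (p - 1)) \<le> 3 * k\<^sup>2" by linarith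
    thus ?thesis using p assms by (intro short_ruler_if_prime) auto
  next
    case 7
    then obtain p where "prime p" "k < p" "2 * (p * (p - 1)) \<le> 3 * k\<^sup>2"
      using prime_for_small_ruler by blast
    thus ?thesis using assms by (intro short_ruler_if_prime) auto
  qed
qed

end
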